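(* Let $\mathcal{G}$ be a chordal graph with vertex set $I=\{1,\dots,n\}$, and suppose that the usual ordering of $\{1,\dots,n\}$ is a perfect elimination ordering of $\mathcal{G}$. Then for every tuple of non-negative integers $\mathbf{m}=(m_i : i\in I)$ and every integer $q\ge 1$, $$\pi_{\mathcal{G}}^{\mathbf{m}}(-q)=(-1)^{|\mathbf{m}|}\prod_{r=1}^{n}\binom{q-1+a_r(\mathbf{m})}{m_r},$$ where $a_r(\mathbf{m})=m_r+\sum_{1\le s<r,\ s\sim r}m_s$ for $1\le r\le n$, and $s\sim r$ means that the vertices $s$ and $r$ are joined by an edge of $\mathcal{G}$.
   Context: All graphs are finite and simple. A graph is chordal if it has no induced subgraph isomorphic to a cycle graph $C_m$ with $m\ge 4$. A total ordering $\le$ on the vertex set $I$ is a perfect elimination ordering if for each $k\in I$ the subgraph induced by $k$ together with all vertices $i\le k$ adjacent to $k$ is a clique (complete subgraph). For $\mathbf{m}=(m_i : i\in I)$ a tuple of non-negative integers, $|\mathbf{m}|=\sum_{i\in I}m_i$. For $q\in\mathbb{N}$, a proper vertex multi-coloring of $\mathcal{G}$ associated to $\mathbf{m}$ using at most $q$ colors is a map $\tau$ from $I$ to the power set of $\{1,\dots,q\}$ such that $|\tau(i)|=m_i$ for all $i\in I$ and $\tau(i)\cap\tau(j)=\emptyset$ whenever $i,j$ are adjacent. The number of such maps is a polynomial in $q$ (i.e. there is a unique polynomial over $\mathbb{Q}$ agreeing with this count for all $q\in\mathbb{N}=\{1,2,\dots\}$), called the generalized chromatic polynomial $\pi_{\mathcal{G}}^{\mathbf{m}}(q)$;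 $\pi_{\mathcal{G}}^{\mathbf{m}}(-q)$ denotes its evaluation at $-q$. Explicitly, $\pi_{\mathcal{G}}^{\mathbf{m}}(q)=\sum_{k\ge 0}|P_k(\mathbf{m},\mathcal{G})|\binom{q}{k}$, where $P_k(\mathbf{m},\mathcal{G})$ is the set of ordered $k$-tuples $(P_1,\dots,P_k)$ of non-empty independent subsets of $I$ whose multiset union contains each $i$ exactly $m_i$ times. Here $\binom{q}{k}=\frac{q(q-1)\cdots(q-k+1)}{k!}$. *)

theory Defs
  imports
    "Graph_Theory.Graph_Theory"
    "HOL-Library.FuncSet"
    "HOL-Computational_Algebra.Polynomial"
begin

text \<open>
  A finite simple graph is a \<open>pair_graph\<close>: an edge joining \<open>u\<close> and \<open>v\<close> is stored
  as both arcs \<open>(u, v)\<close> and \<open>(v, u)\<close>, and there are no loops.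
\<close>

text \<open>The cycle graph on the vertices \<open>0, \<dots>, m - 1\<close>; it is a cycle only for \<open>m \<ge> 3\<close>.\<close>

definition cycle_graph :: "nat \<Rightarrow> nat pair_pre_digraph" where
  "cycle_graph m =
     \<lparr> pverts = {..<m},
       parcs = {(i, j). i < m \<and> j < m \<and> (j = Suc i mod m \<or> i = Suc j mod m)} \<rparr>"

definition chordal :: "'a pair_pre_digraph \<Rightarrow> bool" where
  "chordal G \<longleftrightarrow>
     \<not> (\<exists>m\<ge>4. \<exists>H. induced_subgraph H (with_proj G)
                  \<and> digraph_iso H (with_proj (cycle_graph m)))"

text \<open>
  A set of vertices is a clique if the subgraph it induces is complete.
  The ordering is a relation \<open>r\<close>, with \<open>(i, k) \<in> r\<close> meaning that \<open>i\<close> is at most \<open>k\<close>.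
\<close>

definition perfect_elimination_ordering :: "'a pair_pre_digraph \<Rightarrow> 'a rel \<Rightarrow> bool" where
  "perfect_elimination_ordering G r \<longleftrightarrow>
     linear_order_on (pverts G) r \<and>
     (\<forall>k\<in>pverts G.
        let W = insert k {i \<in> pverts G. (i, k) \<in> r \<and> (i, k) \<in> parcs G}
        in complete_digraph (card W) (with_proj G \<restriction> W))"

text \<open>Extensionality outside the vertex set makes each coloring be counted once.\<close>

definition multi_colorings ::
    "'a pair_pre_digraph \<Rightarrow> ('a \<Rightarrow> nat) \<Rightarrow> nat \<Rightarrow> ('a \<Rightarrow> nat set) set" where
  "multi_colorings G m q =
     {\<tau> \<in> pverts G \<rightarrow>\<^sub>E Pow {1..q}.
        (\<forall>i\<in>pverts G. card (\<tau> i) = m i) \<and>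
        (\<forall>(i, j)\<in>parcs G. \<tau> i \<inter> \<tau> j = {})}"

definition generalized_chromatic_poly ::
    "'a pair_pre_digraph \<Rightarrow> ('a \<Rightarrow> nat) \<Rightarrow> rat poly" where
  "generalized_chromatic_poly G m =
     (THE p. \<forall>q\<ge>1. poly p (of_nat q) = of_nat (card (multi_colorings G m q)))"

definition weight_upto :: "nat pair_pre_digraph \<Rightarrow> (nat \<Rightarrow> nat) \<Rightarrow> nat \<Rightarrow> nat" where
  "weight_upto G m r = m r + (\<Sum>s | 1 \<le> s \<and> s < r \<and> (s, r) \<in> parcs G. m s)"

end

theory Submission
  imports Defs
begin

text \<open>
  Color the vertices in the elimination order. When vertex \<open>r\<close> is reached, its earlier neighbours
  form a clique, so their color sets are pairwise disjoint and block exactly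
  \<open>b\<^sub>r = a\<^sub>r - m\<^sub>r\<close> colors, whatever the coloring so far. Hence the count is the product of
  the \<open>(q - b\<^sub>r) choose m\<^sub>r\<close>, a polynomial in \<open>q\<close>; evaluating it at \<open>-q\<close> and negating the
  upper index of each binomial coefficient gives the formula.
\<close>

text \<open>The count goes by induction over initial sets of vertices. A plain record of pairs keeps
  each induced subgraph in the type to which \<open>multi_colorings\<close> applies.\<close>

abbreviation induced_pair :: "'a pair_pre_digraph \<Rightarrow> 'a set \<Rightarrow> 'a pair_pre_digraph" where
  "induced_pair G V \<equiv> \<lparr>pverts = V, parcs = parcs G \<inter> V \<times> V\<rparr>"

text \<open>Both \<open>i\<close> and \<open>j\<close> lie in the clique attached to
  \<open>k\<close>, and every arc of an induced subgraph is an arc of \<open>G\<close>.\<close>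

lemma perfect_elimination_ordering_adjacent:
  assumes "perfect_elimination_ordering G r" "k \<in> pverts G"
    and "i \<in> pverts G" "(i, k) \<in> r" "(i, k) \<in> parcs G"
    and "j \<in> pverts G" "(j, k) \<in> r" "(j, k) \<in> parcs G" "i \<noteq> j"
  shows "(i, j) \<in> parcs G"
proof -
  let ?W = "insert k {i \<in> pverts G. (i, k) \<in> r \<and> (i, k) \<in> parcs G}"
  have "complete_digraph (card ?W) (with_proj G \<restriction> ?W)"
    using assms(1,2) unfolding perfect_elimination_ordering_def Let_def by blast
  then have "arcs_ends (with_proj G \<restriction> ?W) = {(u, v). (u, v) \<in> ?W \<times> ?W \<and> u \<noteq> v}"
    by (simp add: complete_digraph_def)
  then have "(i, j) \<in> arcs_ends (with_proj G \<restriction> ?W)"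
    using assms by auto
  then show ?thesis
    by (auto simp: arcs_ends_def arc_to_ends_def)
qed

lemma finite_multi_colorings:
  assumes "finite (pverts G)"
  shows "finite (multi_colorings G m q)"
  unfolding multi_colorings_def
  by (rule finite_subset[of _ "pverts G \<rightarrow>\<^sub>E Pow {1..q}"]) (auto intro: finite_PiE assms)

lemma multi_colorings_induced_iff:
  "\<tau> \<in> multi_colorings (induced_pair G V) m q \<longleftrightarrow>
     \<tau> \<in> V \<rightarrow>\<^sub>E Pow {1..q} \<and> (\<forall>i\<in>V. card (\<tau> i) = m i) \<and>
     (\<forall>i\<in>V. \<forall>j\<in>V. (i, j) \<in> parcs G \<longrightarrow> \<tau> i \<inter> \<tau> j = {})"
  unfolding multi_colorings_def by (simp del: atLeastAtMost_iff) blast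

lemma multi_colorings_disjoint:
  assumes "\<tau> \<in> multi_colorings (induced_pair G V) m q" "(i, j) \<in> parcs G" "i \<in> V" "j \<in> V"
  shows "\<tau> i \<inter> \<tau> j = {}"
  using assms unfolding multi_colorings_induced_iff by blast

text \<open>The only constraints that \<open>v\<close> adds link it to its neighbours in
  \<open>V\<close>. Extending a coloring of \<open>V\<close> therefore means choosing a set of
  \<open>m v\<close> colors that avoids those on \<open>N\<close>.\<close>

lemma bij_betw_multi_colorings_insert:
  assumes "v \<notin> V" "sym (parcs G)" "(v, v) \<notin> parcs G"
  defines "N \<equiv> {i \<in> V. (i, v) \<in> parcs G}"
  shows "bij_betw (\<lambda>(\<tau>, S). \<tau>(v := S))
    (SIGMA \<tau>:multi_colorings (induced_pair G V) m q.
       {S. S \<subseteq> {1..q} - (\<Union>i\<in>N. \<tau> i) \<and> card S = m v})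
    (multi_colorings (induced_pair G (insert v V)) m q)"
\<comment> \<open>Resetting \<open>v\<close> to \<open>undefined\<close> restricts a coloring to
  \<open>V\<close>, as extensionality demands. It undoes the update because \<tau> is already
  \<open>undefined\<close> at \<open>v\<close> when \<open>v\<close> is outside
  \<open>V\<close>.\<close>
proof (rule bij_betw_byWitness[where f' = "\<lambda>\<tau>. (\<tau>(v := undefined), \<tau> v)"], goal_cases)
  case 1
  show ?case
    using assms(1) by (auto simp: multi_colorings_def PiE_iff extensional_def fun_eq_iff)
next
  case 2
  show ?case by auto
next
  case 3
  have "\<tau>(v := S) \<in> multi_colorings (induced_pair G (insert v V)) m q"
    if \<tau>: "\<tau> \<in> multi_colorings (induced_pair G V) m q"
      and S: "S \<subseteq> {1..q} - (\<Union>i\<in>N. \<tau> i)" "card S = m v" for \<tau> S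
  proof -
    have "\<tau>(v := S) \<in> insert v V \<rightarrow>\<^sub>E Pow {1..q}"
      using \<tau> S by (auto simp: multi_colorings_def PiE_iff extensional_def)
    moreover have "card ((\<tau>(v := S)) i) = m i" if "i \<in> insert v V" for i
      using \<tau> S that by (auto simp: multi_colorings_def)
    moreover have "(\<tau>(v := S)) i \<inter> (\<tau>(v := S)) j = {}"
      if "(i, j) \<in> parcs G" "i \<in> insert v V" "j \<in> insert v V" for i j
    proof -
      \<comment> \<open>\<open>N\<close> only records arcs into \<open>v\<close>; symmetry handles
        the case \<open>i = v\<close>.\<close>
      have "(j, i) \<in> parcs G" using that assms(2) by (auto dest: symD)
      moreover have "\<tau> i \<inter> \<tau> j = {}" if "i \<in> V" "j \<in> V"
        using \<tau> \<open>(i, j) \<in> parcs G\<close> that by (rule multi_colorings_disjoint)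
      ultimately show ?thesis
        using that S(1) assms(1,3) by (auto simp: N_def)
    qed
    ultimately show ?thesis
      unfolding multi_colorings_induced_iff by blast
  qed
  then show ?case
    by (intro image_subsetI, elim SigmaE) simp
next
  case 4
  show ?case
  proof (rule image_subsetI)
    fix \<tau> assume \<tau>: "\<tau> \<in> multi_colorings (induced_pair G (insert v V)) m q"
    have disj: "\<tau> i \<inter> \<tau> j = {}"
      if "(i, j) \<in> parcs G" "i \<in> insert v V" "j \<in> insert v V" for i j
      using \<tau> that by (rule multi_colorings_disjoint)
    have "\<tau>(v := undefined) \<in> V \<rightarrow>\<^sub>E Pow {1..q}"
      using \<tau> assms(1) unfolding multi_colorings_induced_iff
      by (auto simp: PiE_iff extensional_def)
    moreover have "card ((\<tau>(v := undefined)) i) = m i" if "i \<in> V" for i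
      using \<tau> that assms(1) unfolding multi_colorings_induced_iff by auto
    moreover have "(\<tau>(v := undefined)) i \<inter> (\<tau>(v := undefined)) j = {}"
      if "(i, j) \<in> parcs G" "i \<in> V" "j \<in> V" for i j
      using that disj[of i j] assms(1) by auto
    ultimately have "\<tau>(v := undefined) \<in> multi_colorings (induced_pair G V) m q"
      unfolding multi_colorings_induced_iff by blast
    moreover have "\<tau> v \<subseteq> {1..q} - (\<Union>i\<in>N. (\<tau>(v := undefined)) i)"
    proof -
      have "\<tau> v \<subseteq> {1..q}"
        using \<tau> unfolding multi_colorings_induced_iff PiE_iff by blast
      \<comment> \<open>Since \<open>i\<close> differs from \<open>v\<close>, the reset at
        \<open>v\<close> does not change the colors blocked by \<open>N\<close>.\<close>
      moreover have "\<tau> i \<inter> \<tau> v = {}" "i \<noteq> v" if "i \<in> N" for i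
        using that disj[of i v] assms(1) by (auto simp: N_def)
      ultimately show ?thesis by fastforce
    qed
    moreover have "card (\<tau> v) = m v"
      using \<tau> by (auto simp: multi_colorings_def)
    ultimately show "(\<tau>(v := undefined), \<tau> v) \<in>
      (SIGMA \<tau>:multi_colorings (induced_pair G V) m q.
         {S. S \<subseteq> {1..q} - (\<Union>i\<in>N. \<tau> i) \<and> card S = m v})"
      by blast
  qed
qed

text \<open>All fibres of the preceding bijection have the same size, because disjointness on the
  clique \<open>N\<close> fixes the number of blocked colors. With \<open>gchoose\<close> over a
  field the factor is polynomial in \<open>q\<close>; if the blocked weight exceeds
  \<open>q\<close>, no coloring of \<open>V\<close> exists and both sides vanish.\<close>

lemma card_multi_colorings_insert:
  assumes "finite V" "v \<notin> V" "sym (parcs G)" "(v, v) \<notin> parcs G"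
  defines "N \<equiv> {i \<in> V. (i, v) \<in> parcs G}"
  assumes clique: "\<And>i j. i \<in> N \<Longrightarrow> j \<in> N \<Longrightarrow> i \<noteq> j \<Longrightarrow> (i, j) \<in> parcs G"
  shows "(of_nat (card (multi_colorings (induced_pair G (insert v V)) m q)) :: 'b :: field_char_0) =
    of_nat (card (multi_colorings (induced_pair G V) m q)) *
    ((of_nat q - of_nat (\<Sum>i\<in>N. m i)) gchoose m v)"
proof -
  let ?C = "multi_colorings (induced_pair G V) m q"
  let ?A = "\<lambda>\<tau>. {S. S \<subseteq> {1..q} - (\<Union>i\<in>N. \<tau> i) \<and> card S = m v}"
  have "of_nat (card (?A \<tau>)) = (of_nat q - of_nat (\<Sum>i\<in>N. m i) :: 'b) gchoose m v"
    if \<tau>: "\<tau> \<in> ?C" for \<tau>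
  proof -
    have sub: "\<tau> i \<subseteq> {1..q}" and card: "card (\<tau> i) = m i" if "i \<in> N" for i
      using \<tau> that by (auto simp: multi_colorings_def N_def)
    have "card (\<Union>i\<in>N. \<tau> i) = (\<Sum>i\<in>N. card (\<tau> i))"
    proof (rule card_UN_disjoint)
      show "finite N" using assms(1) by (simp add: N_def)
      show "\<forall>i\<in>N. finite (\<tau> i)" using sub finite_subset by blast
      show "\<forall>i\<in>N. \<forall>j\<in>N. i \<noteq> j \<longrightarrow> \<tau> i \<inter> \<tau> j = {}"
        using multi_colorings_disjoint[OF \<tau>] clique unfolding N_def by blast
    qed
    then have N: "card (\<Union>i\<in>N. \<tau> i) = (\<Sum>i\<in>N. m i)" by (simp add: card)
    have U: "(\<Union>i\<in>N. \<tau> i) \<subseteq> {1..q}" using sub by blast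
    \<comment> \<open>The existence of \<tau> gives this bound, so the subtraction of naturals below
      is not truncated.\<close>
    have "(\<Sum>i\<in>N. m i) \<le> q" using card_mono[OF _ U] N by simp
    moreover have "card ({1..q} - (\<Union>i\<in>N. \<tau> i)) = q - (\<Sum>i\<in>N. m i)"
      using U N by (simp add: card_Diff_subset finite_subset)
    ultimately show ?thesis
      by (simp add: n_subsets binomial_gbinomial of_nat_diff)
  qed
  moreover have "finite ?C" using assms(1) by (simp add: finite_multi_colorings)
  ultimately have "(of_nat (card (Sigma ?C ?A)) :: 'b) =
    of_nat (card ?C) * ((of_nat q - of_nat (\<Sum>i\<in>N. m i)) gchoose m v)"
    by (subst card_SigmaI) simp_all
  moreover have "card (Sigma ?C ?A) = card (multi_colorings (induced_pair G (insert v V)) m q)"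
    using bij_betw_multi_colorings_insert[OF assms(2-4)] unfolding N_def by (rule bij_betw_same_card)
  ultimately show ?thesis by simp
qed

lemma card_multi_colorings_perfect_elimination:
  fixes G :: "nat pair_pre_digraph"
  assumes "pair_graph G" and verts: "pverts G = {1..n}"
    and peo: "perfect_elimination_ordering G {(i, j). i \<in> {1..n} \<and> j \<in> {1..n} \<and> i \<le> j}"
  shows "(of_nat (card (multi_colorings G m q)) :: 'b :: field_char_0) =
    (\<Prod>r = 1..n. (of_nat q - of_nat (\<Sum>s | 1 \<le> s \<and> s < r \<and> (s, r) \<in> parcs G. m s)) gchoose m r)"
proof -
  interpret pair_graph G by fact
  have sym: "sym (parcs G)"
    using sym_arcs by (auto simp: symmetric_def)
  have count: "(of_nat (card (multi_colorings (induced_pair G {1..k}) m q)) :: 'b) =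
    (\<Prod>r = 1..k. (of_nat q - of_nat (\<Sum>s | 1 \<le> s \<and> s < r \<and> (s, r) \<in> parcs G. m s)) gchoose m r)"
    if "k \<le> n" for k
    using that
  proof (induction k)
    case 0
    \<comment> \<open>Without vertices the everywhere \<open>undefined\<close> function is the only
      coloring, which matches the empty product.\<close>
    show ?case by (simp add: multi_colorings_def)
  next
    case (Suc k)
    let ?N = "{i \<in> {1..k}. (i, Suc k) \<in> parcs G}"
    \<comment> \<open>In the usual ordering, the neighbours already colored are exactly the smaller
      ones.\<close>
    have N: "?N = {s. 1 \<le> s \<and> s < Suc k \<and> (s, Suc k) \<in> parcs G}" by auto
    have clique: "(i, j) \<in> parcs G" if "i \<in> ?N" "j \<in> ?N" "i \<noteq> j" for i j
      by (rule perfect_elimination_ordering_adjacent[OF peo, where k = "Suc k"])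
        (use that Suc.prems in \<open>auto simp: verts\<close>)
    have irr: "(Suc k, Suc k) \<notin> parcs G" using pair_no_loops by force
    have insert_Suc: "{1..Suc k} = insert (Suc k) {1..k}" by auto
    note step = card_multi_colorings_insert[of "{1..k}" "Suc k" G m q,
        where 'b = 'b, OF _ _ sym irr clique, folded insert_Suc]
    have "(of_nat (card (multi_colorings (induced_pair G {1..Suc k}) m q)) :: 'b) =
      of_nat (card (multi_colorings (induced_pair G {1..k}) m q)) *
      ((of_nat q - of_nat (\<Sum>i\<in>?N. m i)) gchoose m (Suc k))"
      by (rule step) simp_all
    also note Suc.IH[OF Suc_leD[OF Suc.prems]]
    finally show ?case unfolding N by simp
  qed
  have induced: "induced_pair G {1..n} = G"
  proof -
    have "parcs G \<inter> pverts G \<times> pverts G = parcs G"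
      by (auto dest: in_arcsD1 in_arcsD2)
    then show ?thesis unfolding verts[symmetric] by simp
  qed
  show ?thesis using count[OF order_refl] unfolding induced .
qed

text \<open>Two polynomials with the prescribed values agree at all positive integers, so their
  difference has infinitely many roots.\<close>

lemma generalized_chromatic_poly_eqI:
  assumes "\<And>q. poly p (of_nat q) = of_nat (card (multi_colorings G m q))"
  shows "generalized_chromatic_poly G m = p"
  unfolding generalized_chromatic_poly_def
proof (rule the_equality)
  fix p' :: "rat poly"
  assume p': "\<forall>q\<ge>1. poly p' (of_nat q) = of_nat (card (multi_colorings G m q))"
  show "p' = p"
  proof (rule ccontr)
    assume "p' \<noteq> p"
    then have "finite {x. poly (p' - p) x = 0}" by (intro poly_roots_finite) simp
    moreover have "of_nat ` {1..} \<subseteq> {x. poly (p' - p) x = 0}" using p' assms by auto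
    ultimately have "finite (of_nat ` {1..} :: rat set)" by (rule finite_subset[rotated])
    then show False
      by (metis finite_imageD infinite_Ici inj_on_of_nat)
  qed
qed (use assms in auto)

text \<open>For fixed \<open>k\<close> the binomial coefficient is a product of \<open>k\<close>
  linear factors divided by \<open>k!\<close>.\<close>

lemma ex_poly_gchoose:
  fixes b :: "'a :: field_char_0"
  shows "\<exists>p. \<forall>x. poly p x = (x - b) gchoose k"
proof
  show "\<forall>x. poly (smult (1 / fact k) (\<Prod>i = 0..<k. [:- b - of_nat i, 1:])) x = (x - b) gchoose k"
    by (auto simp: gbinomial_prod_rev poly_prod algebra_simps)
qed

theorem theorem3:
  fixes G :: "nat pair_pre_digraph" and n q :: nat and m :: "nat \<Rightarrow> nat"
  assumes "pair_graph G"
    and "pverts G = {1..n}"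
    and "chordal G"
    and "perfect_elimination_ordering G {(i, j). i \<in> {1..n} \<and> j \<in> {1..n} \<and> i \<le> j}"
    and "q \<ge> 1"
  shows "poly (generalized_chromatic_poly G m) (- of_nat q) =
    (- 1) ^ (\<Sum>i = 1..n. m i) *
    (\<Prod>r = 1..n. of_nat ((q - 1 + weight_upto G m r) choose m r))"
proof -
  \<comment> \<open>\<open>b r\<close> is the number of colors blocked at \<open>r\<close>, so
    \<open>weight_upto G m r\<close> equals \<open>m r + b r\<close>.\<close>
  define b where "b r = (\<Sum>s | 1 \<le> s \<and> s < r \<and> (s, r) \<in> parcs G. m s)" for r
  obtain p :: "nat \<Rightarrow> rat poly" where p: "poly (p r) x = (x - of_nat (b r)) gchoose m r" for r x
  proof -
    have "\<forall>r. \<exists>p :: rat poly. \<forall>x. poly p x = (x - of_nat (b r)) gchoose m r"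
      using ex_poly_gchoose by blast
    then show thesis using that by metis
  qed
  have "generalized_chromatic_poly G m = (\<Prod>r = 1..n. p r)"
    using card_multi_colorings_perfect_elimination[OF assms(1,2,4), of m, where 'b = rat]
    by (intro generalized_chromatic_poly_eqI) (simp add: poly_prod p b_def)
  then have "poly (generalized_chromatic_poly G m) (- of_nat q) =
      (\<Prod>r = 1..n. (- of_nat q - of_nat (b r)) gchoose m r)"
    by (simp add: poly_prod p)
  also have "\<dots> = (\<Prod>r = 1..n. (- 1) ^ m r * of_nat ((q - 1 + weight_upto G m r) choose m r))"
  proof (rule prod.cong[OF refl])
    fix r
    have "(- of_nat q - of_nat (b r) :: rat) gchoose m r =
        (- of_nat (q + b r)) gchoose m r" by simp
    also have "\<dots> = (- 1) ^ m r * ((of_nat (q + b r) + of_nat (m r) - 1) gchoose m r)"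
      by (rule gbinomial_minus)
    \<comment> \<open>Here \<open>q \<ge> 1\<close> matters: it makes \<open>q - 1\<close> on
      naturals agree with the subtraction in the rationals.\<close>
    also have "of_nat (q + b r) + of_nat (m r) - 1 = (of_nat (q - 1 + weight_upto G m r) :: rat)"
      using assms(5) by (simp add: weight_upto_def b_def of_nat_diff)
    finally show "(- of_nat q - of_nat (b r) :: rat) gchoose m r =
        (- 1) ^ m r * of_nat ((q - 1 + weight_upto G m r) choose m r)"
      by (simp add: binomial_gbinomial)
  qed
  finally show ?thesis by (simp add: prod.distrib power_sum)
qed

end
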